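(* Let $K$ be a radically closed field of characteristic $0$ and let $G=\mathrm{Aff}(K)\times\mathrm{Aff}(K)$ act on $K[X]$ by $(\alpha,\beta)\cdot P=\alpha\circ P\circ\beta^{-1}$. (a) In one $G$-orbit $\mathcal{O}$, all polynomials have the same degree, and all $\varrho$-polynomials have the same bi-degree and the same support. (b) Every $G$-orbit $\mathcal{O}$ contains a $\delta$-polynomial. If a $\delta$-polynomial in $\mathcal{O}$ has bi-degree $(d,e)$, then $\mathcal{O}$ contains at most $\Delta=d-e$ $\delta$-polynomials.
   Context: $K$ is radically closed: every polynomial $X^n-a$ ($a\in K$, $n\ge 2$) splits over $K$. $\mathrm{Aff}(K)=\{aX+b\in K[X]: a\ne 0\}$ is a group under composition. A non-constant polynomial $P$ is a $\varrho$-polynomial if $P(X)=a_dX^d$ with $a_d\ne 0$, or $P(X)=a_dX^d+a_eX^e+a_{e-1}X^{e-1}+\dots+a_1X$ with $a_d,a_e\ne 0$ and $1\le e\le d-2$. In the second case the bi-degree of $P$ is $(d,e)$, and the support of $P$ is the decreasing sequence $(d,e,\dots,e_i,\dots)$ of the exponents of monomials with nonzero coefficient in $P$. If $P=a_dX^d$, the support is $(d)$. By convention every constant polynomial (including $0$) has degree $0$ and support $(0)$. A polynomial $P$ of degree $d$ is a $\delta$-polynomial if $P(X)=X^d$ (with $X^0=1$), or $P(X)=X^d+dX^e+a_{e-1}X^{e-1}+\dots+a_1X$ with $1\le e\le d-2$. *)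

theory Defs
  imports "HOL-Computational_Algebra.Polynomial" "HOL-Algebra.Group_Action"
begin

definition splits_into_linear :: "'a::field poly \<Rightarrow> bool" where
  "splits_into_linear p \<longleftrightarrow> (\<exists>c xs. c \<noteq> 0 \<and> p = smult c (\<Prod>x\<leftarrow>xs. [:- x, 1:]))"

definition radically_closed :: "'a::field itself \<Rightarrow> bool" where
  "radically_closed _ \<longleftrightarrow>
     (\<forall>(n::nat) (a::'a). n \<ge> 2 \<longrightarrow> splits_into_linear (monom 1 n - [:a:]))"

definition Aff :: "'a::field poly monoid" where
  "Aff = \<lparr>carrier = {[:b, a:] | a b. a \<noteq> 0}, mult = pcompose, one = [:0, 1:]\<rparr>"

definition aff_action :: "'a::field poly \<times> 'a poly \<Rightarrow> 'a poly \<Rightarrow> 'a poly" where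
  "aff_action = (\<lambda>(\<alpha>, \<beta>) P. pcompose (pcompose \<alpha> P) (inv\<^bsub>Aff\<^esub> \<beta>))"

text \<open>Having a bi-degree is a relation, since a \<open>\<rho>\<close>-polynomial that is a monomial has none.\<close>

definition has_bidegree :: "'a::field poly \<Rightarrow> nat \<Rightarrow> nat \<Rightarrow> bool" where
  "has_bidegree P d e \<longleftrightarrow> 1 \<le> e \<and> e + 2 \<le> d \<and>
     (\<exists>a. a d \<noteq> 0 \<and> a e \<noteq> 0 \<and> P = monom (a d) d + (\<Sum>i = 1..e. monom (a i) i))"

definition rho_polynomial :: "'a::field poly \<Rightarrow> bool" where
  "rho_polynomial P \<longleftrightarrow>
     (\<exists>d a. 1 \<le> d \<and> a \<noteq> 0 \<and> P = monom a d) \<or> (\<exists>d e. has_bidegree P d e)"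

definition poly_support :: "'a::field poly \<Rightarrow> nat list" where
  "poly_support P =
     (if degree P = 0 then [0] else rev (sorted_list_of_set {i. coeff P i \<noteq> 0}))"

definition delta_polynomial :: "'a::field poly \<Rightarrow> bool" where
  "delta_polynomial P \<longleftrightarrow> (let d = degree P in
     P = monom 1 d \<or>
     (\<exists>e a. 1 \<le> e \<and> e + 2 \<le> d \<and>
        P = monom 1 d + monom (of_nat d) e + (\<Sum>i = 1..<e. monom (a i) i)))"

lemma Aff_simps [simp]:
  "carrier Aff = {[:b, a:] | a b. a \<noteq> 0}"
  "mult Aff = pcompose"
  "one Aff = [:0, 1:]"
  by (simp_all add: Aff_def)

lemma group_Aff: "group (Aff :: 'a::field poly monoid)"
proof (rule groupI)
  fix x :: "'a poly" assume "x \<in> carrier Aff"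
  then obtain a b where x: "x = [:b, a:]" "a \<noteq> 0" by auto
  have "pcompose [:- b / a, 1 / a:] x = [:0, 1:]"
    using x by (simp add: pcompose_pCons)
  then show "\<exists>y\<in>carrier Aff. y \<otimes>\<^bsub>Aff\<^esub> x = \<one>\<^bsub>Aff\<^esub>"
    using x(2) by (intro bexI[of _ "[:- b / a, 1 / a:]"]) auto
qed (auto simp: pcompose_pCons pcompose_assoc)

lemma pcompose_X_left: "pcompose [:0, 1:] (p :: 'a::comm_semiring_1 poly) = p"
  by (simp add: pcompose_pCons)

lemma group_action_aff:
  "group_action (Aff \<times>\<times> Aff) (UNIV :: 'a::field poly set) aff_action"
proof -
  interpret A: group "Aff :: 'a poly monoid" by (rule group_Aff)
  let ?G = "Aff \<times>\<times> (Aff :: 'a poly monoid)"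
  have G: "group ?G" by (rule DirProd_group[OF group_Aff group_Aff])
  interpret G: group ?G by (rule G)
  have mult: "aff_action (g \<otimes>\<^bsub>?G\<^esub> h) = aff_action g \<circ> aff_action h"
    if "g \<in> carrier ?G" "h \<in> carrier ?G" for g h
  proof -
    obtain \<alpha> \<beta> \<alpha>' \<beta>' where gh: "g = (\<alpha>, \<beta>)" "h = (\<alpha>', \<beta>')" by fastforce
    have "inv\<^bsub>Aff\<^esub> (\<beta> \<otimes>\<^bsub>Aff\<^esub> \<beta>') = inv\<^bsub>Aff\<^esub> \<beta>' \<otimes>\<^bsub>Aff\<^esub> inv\<^bsub>Aff\<^esub> \<beta>"
      using that gh by (intro A.inv_mult_group) auto
    then show ?thesis
      using gh by (auto simp: aff_action_def pcompose_assoc fun_eq_iff)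
  qed
  have one: "aff_action \<one>\<^bsub>?G\<^esub> = (id :: 'a poly \<Rightarrow> 'a poly)"
    using A.inv_one by (auto simp: aff_action_def fun_eq_iff pcompose_X_left pcompose_idR)
  have bij: "bij (aff_action g)" if "g \<in> carrier ?G" for g
    by (rule o_bij[of "aff_action (inv\<^bsub>?G\<^esub> g)"])
      (metis mult one that G.inv_closed G.l_inv G.r_inv)+
  have "aff_action \<in> hom ?G (BijGroup (UNIV :: 'a poly set))"
    using bij mult
    by (auto simp: hom_def BijGroup_def Bij_def compose_def extensional_def restrict_def
        fun_eq_iff simp del: carrier_DirProd)
  then show ?thesis
    unfolding group_action_def group_hom_def group_hom_axioms_def
    using G group_BijGroup by blast
qed

end

theory Submission
  imports Defs
begin

text \<open>
  Two polynomials lie in one orbit iff \<open>Q = \<alpha> \<circ> P \<circ> \<gamma>\<close> for affine \<open>\<alpha>\<close> and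
  \<open>\<gamma>\<close>, so degrees agree along an orbit. Everything else comes from watching two coefficients of
  a polynomial of degree \<open>d \<ge> 1\<close>. Being a \<open>\<rho>\<close>-polynomial means precisely that the
  coefficients of \<open>X\<^sup>0\<close> and of \<open>X\<close> to the power \<open>d - 1\<close> vanish
  (\<open>rho_polynomial_iff_coeff\<close>). In characteristic \<open>0\<close> the second condition can
  be reached by an inner translation, which is then unique if \<open>d \<ge> 2\<close>
  (\<open>coeff_pcompose_subleading\<close>); the first fixes the outer translation. Hence
  two \<open>\<rho>\<close>-polynomials in one orbit differ by scalings only,
  \<open>Q = a P(b X)\<close> (\<open>rho_equivalent_imp_scaling\<close>). Such scalings do not change which
  coefficients vanish, and this gives the invariance of the bi-degree and the support.

  For \<open>\<delta>\<close>-polynomials it remains to choose \<open>a\<close> and \<open>b\<close>. If the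
  bi-degree is \<open>(d, e)\<close>, prescribing the coefficients \<open>1\<close> and \<open>d\<close> at the
  exponents \<open>d\<close> and \<open>e\<close> determines \<open>a\<close> from \<open>b\<close> and prescribes the
  power of \<open>b\<close> with exponent \<open>d - e \<ge> 2\<close>. Radical closure supplies such a
  \<open>b\<close> (\<open>rho_imp_exists_equivalent_delta\<close>). If the polynomial is a
  \<open>\<delta>\<close>-polynomial already, the admissible \<open>b\<close> are roots of unity of order
  dividing \<open>d - e\<close>, and each yields one \<open>\<delta>\<close>-polynomial
  (\<open>delta_equivalent_imp_root_of_unity\<close>), whence the bound.
\<close>

section \<open>Coefficients under affine substitutions\<close>

lemma coeff_pcompose_top:
  fixes P :: "'a::comm_semiring_1 poly"
  assumes "degree P \<le> n"
  shows "coeff (pcompose P [:c, b:]) n = b ^ n * coeff P n"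
  using assms
proof (induction P arbitrary: n)
  case 0
  then show ?case by simp
next
  case (pCons p P)
  show ?case
  proof (cases n)
    case 0
    then have "P = 0" using pCons.prems by (auto split: if_splits)
    then show ?thesis using 0 by simp
  next
    case (Suc m)
    then have "degree P \<le> m" using pCons.prems by (auto split: if_splits)
    then have "coeff (pcompose P [:c, b:]) m = b ^ m * coeff P m"
      and "coeff (pcompose P [:c, b:]) (Suc m) = 0"
      using pCons.IH[of m] pCons.IH[of "Suc m"] by (auto simp: coeff_eq_0)
    then show ?thesis using Suc by (simp add: pcompose_pCons mult.assoc)
  qed
qed

text \<open>
  Only the two top terms of \<open>P\<close> reach this exponent, and the top one contributes the linear
  term in \<open>c\<close> of the binomial expansion of \<open>(c + b X)\<close> to the power \<open>n + 1\<close>. Over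
  a field of characteristic \<open>0\<close>, if \<open>b \<noteq> 0\<close> and the degree is exactly
  \<open>n + 1\<close>, there is thus exactly one \<open>c\<close> for which the coefficient vanishes.
\<close>

lemma coeff_pcompose_subleading:
  fixes P :: "'a::comm_semiring_1 poly"
  assumes "degree P \<le> Suc n"
  shows "coeff (pcompose P [:c, b:]) n =
    b ^ n * (coeff P n + of_nat (Suc n) * c * coeff P (Suc n))"
  using assms
proof (induction P arbitrary: n)
  case 0
  then show ?case by simp
next
  case (pCons p P)
  then have dP: "degree P \<le> n" by (auto split: if_splits)
  have top: "coeff (pcompose P [:c, b:]) n = b ^ n * coeff P n"
    by (rule coeff_pcompose_top[OF dP])
  show ?case
  proof (cases n)
    case 0
    then show ?thesis using top by (simp add: pcompose_pCons)
  next
    case (Suc m)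
    then show ?thesis using top dP pCons.IH[of m]
      by (simp add: pcompose_pCons algebra_simps)
  qed
qed

lemma coeff_affine_pcompose:
  fixes P :: "'a::comm_semiring_1 poly"
  shows "coeff (pcompose [:k, a:] P) n = (if n = 0 then k else 0) + a * coeff P n"
  by (cases n) (simp_all add: pcompose_pCons)

section \<open>Affine equivalence\<close>

text \<open>
  The inner factor occurs here directly instead of as an inverse, so that the coefficient formulas
  above apply; as inversion permutes the affine group, the orbits are the same.
\<close>

definition affine_equivalent :: "'a::field poly \<Rightarrow> 'a poly \<Rightarrow> bool" where
  "affine_equivalent P Q \<longleftrightarrow>
     (\<exists>k a c b. a \<noteq> 0 \<and> b \<noteq> 0 \<and> Q = pcompose [:k, a:] (pcompose P [:c, b:]))"

lemma orbit_eq_affine_equivalent: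
  assumes "\<O> \<in> orbits (Aff \<times>\<times> Aff) (UNIV :: 'a::field poly set) aff_action" and "P \<in> \<O>"
  shows "\<O> = {Q. affine_equivalent P Q}"
proof -
  interpret A: group "Aff :: 'a poly monoid" by (rule group_Aff)
  interpret act: group_action "Aff \<times>\<times> Aff" "UNIV :: 'a poly set" aff_action
    by (rule group_action_aff)
  obtain R where R: "\<O> = orbit (Aff \<times>\<times> Aff) aff_action R"
    using assms(1) by (auto simp: orbits_def)
  have sub: "orbit (Aff \<times>\<times> Aff) aff_action S \<subseteq> orbit (Aff \<times>\<times> Aff) aff_action T"
    if "S \<in> orbit (Aff \<times>\<times> Aff) aff_action T" for S T :: "'a poly"
    using act.orbit_trans[of T S] that by auto
  have "\<O> = orbit (Aff \<times>\<times> Aff) aff_action P"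
    using sub[of P R] sub[of R P] act.orbit_sym[of R P] assms(2) R by auto
  also have "\<dots> = {Q. affine_equivalent P Q}"
  proof (intro Set.set_eqI iffI)
    fix Q assume "Q \<in> orbit (Aff \<times>\<times> Aff) aff_action P"
    then obtain \<alpha> \<beta> where ab: "\<alpha> \<in> carrier Aff" "\<beta> \<in> carrier Aff" "Q = aff_action (\<alpha>, \<beta>) P"
      by (auto simp: orbit_def simp del: Aff_simps)
    moreover have "inv\<^bsub>Aff\<^esub> \<beta> \<in> carrier Aff" using ab by blast
    ultimately show "Q \<in> {Q. affine_equivalent P Q}"
      by (fastforce simp: aff_action_def affine_equivalent_def pcompose_assoc)
  next
    fix Q assume "Q \<in> {Q. affine_equivalent P Q}"
    then obtain k a c b where Q: "a \<noteq> 0" "b \<noteq> 0"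
        "Q = pcompose [:k, a:] (pcompose P [:c, b:])"
      by (auto simp: affine_equivalent_def)
    have c: "[:k, a:] \<in> carrier Aff" "[:c, b:] \<in> carrier Aff" using Q by auto
    have "Q = aff_action ([:k, a:], inv\<^bsub>Aff\<^esub> [:c, b:]) P"
      using Q A.inv_inv[OF c(2)] by (simp add: aff_action_def pcompose_assoc)
    then show "Q \<in> orbit (Aff \<times>\<times> Aff) aff_action P"
      using c A.inv_closed[OF c(2)] by (auto simp: orbit_def simp del: Aff_simps)
  qed
  finally show ?thesis .
qed

lemma degree_affine_equivalent:
  assumes "affine_equivalent P Q"
  shows "degree Q = degree P"
  using assms by (auto simp: affine_equivalent_def degree_pcompose)

section \<open>Normal forms read off from coefficients\<close>

lemma coeff_monom_plus_sum:
  fixes a :: "nat \<Rightarrow> 'a::comm_monoid_add"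
  shows "coeff (monom x d + (\<Sum>i = 1..e. monom (a i) i)) n =
    (if n = d then x else 0) + (if 1 \<le> n \<and> n \<le> e then a n else 0)"
  by (auto simp: coeff_sum)

lemma has_bidegree_iff_coeff:
  "has_bidegree P d e \<longleftrightarrow>
     1 \<le> e \<and> e + 2 \<le> d \<and> degree P = d \<and> coeff P e \<noteq> 0 \<and> coeff P 0 = 0 \<and>
     (\<forall>i. e < i \<longrightarrow> i < d \<longrightarrow> coeff P i = 0)"
proof (intro iffI)
  assume "has_bidegree P d e"
  then obtain a where a: "1 \<le> e" "e + 2 \<le> d" "a d \<noteq> 0" "a e \<noteq> 0"
      and P: "P = monom (a d) d + (\<Sum>i = 1..e. monom (a i) i)"
    by (auto simp: has_bidegree_def)
  have c: "coeff P n = (if n = d then a d else 0) + (if 1 \<le> n \<and> n \<le> e then a n else 0)" for n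
    unfolding P by (rule coeff_monom_plus_sum)
  have "degree P = d"
    using a by (intro antisym degree_le le_degree) (auto simp: c)
  then show "1 \<le> e \<and> e + 2 \<le> d \<and> degree P = d \<and> coeff P e \<noteq> 0 \<and> coeff P 0 = 0 \<and>
     (\<forall>i. e < i \<longrightarrow> i < d \<longrightarrow> coeff P i = 0)"
    using a by (auto simp: c)
next
  assume R: "1 \<le> e \<and> e + 2 \<le> d \<and> degree P = d \<and> coeff P e \<noteq> 0 \<and> coeff P 0 = 0 \<and>
     (\<forall>i. e < i \<longrightarrow> i < d \<longrightarrow> coeff P i = 0)"
  have "P = monom (coeff P d) d + (\<Sum>i = 1..e. monom (coeff P i) i)"
  proof (rule poly_eqI)
    fix n
    show "coeff P n = coeff (monom (coeff P d) d + (\<Sum>i = 1..e. monom (coeff P i) i)) n"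
      unfolding coeff_monom_plus_sum using R
      by (cases "n = 0"; cases "n \<le> e"; cases "n < d"; cases "n = d") (auto simp: coeff_eq_0)
  qed
  moreover have "coeff P d \<noteq> 0" using R by auto
  ultimately show "has_bidegree P d e"
    using R unfolding has_bidegree_def by blast
qed

lemma has_bidegree_unique:
  assumes "has_bidegree P d e" "has_bidegree P d' e'"
  shows "d = d'" "e = e'"
proof -
  show d: "d = d'" using assms by (auto simp: has_bidegree_iff_coeff)
  have "\<not> e < e'" "\<not> e' < e" using assms d by (auto simp: has_bidegree_iff_coeff)
  then show "e = e'" by simp
qed

text \<open>
  The exponent \<open>e\<close> is the largest one below the degree that occurs. The two vanishing
  coefficients force \<open>1 \<le> e\<close> and \<open>e \<le> degree P - 2\<close>.
\<close>

lemma monom_or_has_bidegree: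
  assumes "1 \<le> degree P" "coeff P 0 = 0" "coeff P (degree P - 1) = 0"
  shows "P = monom (lead_coeff P) (degree P) \<or> (\<exists>e. has_bidegree P (degree P) e)"
proof (cases "\<forall>i < degree P. coeff P i = 0")
  case True
  then have "P = monom (lead_coeff P) (degree P)"
    by (intro poly_eqI) (metis coeff_eq_0 coeff_monom linorder_neqE_nat)
  then show ?thesis ..
next
  case False
  define S where "S = {i. i < degree P \<and> coeff P i \<noteq> 0}"
  define e where "e = Max S"
  have S: "finite S" "S \<noteq> {}" using False by (auto simp: S_def)
  then have "e \<in> S" and max: "\<And>i. i \<in> S \<Longrightarrow> i \<le> e" by (auto simp: e_def)
  then have e: "e < degree P" "coeff P e \<noteq> 0" by (auto simp: S_def)
  then have "e \<noteq> 0" "e \<noteq> degree P - 1" using assms by metis+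
  then have "has_bidegree P (degree P) e"
    unfolding has_bidegree_iff_coeff using e assms max by (force simp: S_def)
  then show ?thesis by blast
qed

text \<open>
  The two families of \<open>\<rho>\<close>-polynomials are thus one class cut out by two coefficient equations.
  In degree \<open>1\<close> the two equations coincide.
\<close>

lemma rho_polynomial_iff_coeff:
  "rho_polynomial P \<longleftrightarrow> 1 \<le> degree P \<and> coeff P 0 = 0 \<and> coeff P (degree P - 1) = 0"
proof
  assume "rho_polynomial P"
  then consider d a where "1 \<le> d" "a \<noteq> 0" "P = monom a d" | d e where "has_bidegree P d e"
    by (auto simp: rho_polynomial_def)
  then show "1 \<le> degree P \<and> coeff P 0 = 0 \<and> coeff P (degree P - 1) = 0"
  proof cases
    case 1
    then show ?thesis by (simp add: degree_monom_eq)
  next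
    case 2
    then show ?thesis by (auto simp: has_bidegree_iff_coeff)
  qed
next
  assume R: "1 \<le> degree P \<and> coeff P 0 = 0 \<and> coeff P (degree P - 1) = 0"
  then have "lead_coeff P \<noteq> 0" by auto
  then show "rho_polynomial P"
    using monom_or_has_bidegree[of P] R unfolding rho_polynomial_def by blast
qed

text \<open>
  Characteristic \<open>0\<close> is what makes the prescribed coefficient \<open>d\<close> nonzero, so that
  \<open>e\<close> really is the second component of the bi-degree.
\<close>

lemma delta_polynomial_iff_coeff:
  fixes P :: "'a::field_char_0 poly"
  shows "delta_polynomial P \<longleftrightarrow> P = monom 1 (degree P) \<or>
     (\<exists>e. has_bidegree P (degree P) e \<and> lead_coeff P = 1 \<and> coeff P e = of_nat (degree P))"
proof -
  have "(\<exists>a. 1 \<le> e \<and> e + 2 \<le> degree P \<and>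
          P = monom 1 (degree P) + monom (of_nat (degree P)) e + (\<Sum>i = 1..<e. monom (a i) i))
     \<longleftrightarrow> has_bidegree P (degree P) e \<and> lead_coeff P = 1 \<and> coeff P e = of_nat (degree P)"
    (is "?L \<longleftrightarrow> ?R") for e
  proof
    assume ?L
    then obtain a where e: "1 \<le> e" "e + 2 \<le> degree P" and
        P: "P = monom 1 (degree P) + monom (of_nat (degree P)) e + (\<Sum>i = 1..<e. monom (a i) i)"
      by blast
    have c: "coeff P n = (if n = degree P then 1 else 0) + (if n = e then of_nat (degree P) else 0)
        + (if 1 \<le> n \<and> n < e then a n else 0)" for n
      by (subst P) (auto simp: coeff_sum)
    show ?R using e by (auto simp: has_bidegree_iff_coeff c)
  next
    assume R: ?R
    then have e: "1 \<le> e" "e + 2 \<le> degree P" and low: "coeff P 0 = 0"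
      and gap: "\<And>i. e < i \<Longrightarrow> i < degree P \<Longrightarrow> coeff P i = 0"
      by (auto simp: has_bidegree_iff_coeff)
    have "P = monom 1 (degree P) + monom (of_nat (degree P)) e
        + (\<Sum>i = 1..<e. monom (coeff P i) i)" (is "P = ?S")
    proof (rule poly_eqI)
      fix n
      have "coeff ?S n = (if n = degree P then 1 else 0)
          + (if n = e then of_nat (degree P) else 0) + (if 1 \<le> n \<and> n < e then coeff P n else 0)"
        by (auto simp: coeff_sum)
      then show "coeff P n = coeff ?S n"
        using R e low gap[of n]
        by (cases "n = 0"; cases "n < e"; cases "n = e"; cases "n < degree P"; cases "n = degree P")
          (auto simp: coeff_eq_0)
    qed
    then show ?L using e by blast
  qed
  then show ?thesis unfolding delta_polynomial_def Let_def by blast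
qed

lemma delta_polynomial_imp_rho:
  fixes P :: "'a::field_char_0 poly"
  assumes "delta_polynomial P" "1 \<le> degree P"
  shows "rho_polynomial P"
proof -
  consider "P = monom 1 (degree P)" | e where "has_bidegree P (degree P) e"
    using assms(1) by (auto simp: delta_polynomial_iff_coeff)
  then show ?thesis
  proof cases
    case 1
    then show ?thesis
      unfolding rho_polynomial_def using assms(2) one_neq_zero by blast
  next
    case 2
    then show ?thesis unfolding rho_polynomial_def by blast
  qed
qed

section \<open>Affine equivalences between normal forms\<close>

text \<open>
  If \<open>d \<ge> 2\<close>, the coefficient below the leading one vanishes for both polynomials, which
  forces the inner translation to be trivial; comparing constant terms then removes the outer one.
  In degree \<open>1\<close> an inner translation can be undone by an outer one, so the given
  substitution need not be a scaling; but both polynomials are multiples of \<open>X\<close>.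
\<close>

lemma rho_equivalent_imp_scaling:
  fixes P Q :: "'a::field_char_0 poly"
  assumes "affine_equivalent P Q" "rho_polynomial P" "rho_polynomial Q"
  obtains a b where "a \<noteq> 0" "b \<noteq> 0" "\<And>n. coeff Q n = a * b ^ n * coeff P n"
proof -
  have P: "1 \<le> degree P" "coeff P 0 = 0" "coeff P (degree P - 1) = 0"
    and Q: "degree Q = degree P" "coeff Q 0 = 0" "coeff Q (degree P - 1) = 0"
    using assms degree_affine_equivalent[OF assms(1)] by (auto simp: rho_polynomial_iff_coeff)
  obtain k a c b where ab: "a \<noteq> 0" "b \<noteq> 0" and Qeq: "Q = pcompose [:k, a:] (pcompose P [:c, b:])"
    using assms(1) by (auto simp: affine_equivalent_def)
  have "P \<noteq> 0" "Q \<noteq> 0" using P(1) Q(1) by auto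
  then have lead: "coeff P (degree P) \<noteq> 0" "coeff Q (degree P) \<noteq> 0"
    using leading_coeff_neq_0[of Q] unfolding Q(1) by auto
  show ?thesis
  proof (cases "degree P = 1")
    case True
    have "coeff Q n = coeff Q 1 / coeff P 1 * 1 ^ n * coeff P n" for n
    proof -
      consider "n = 0" | "n = 1" | "1 < n" by linarith
      then show ?thesis
        using P(2) Q(1,2) True lead by cases (simp_all add: coeff_eq_0)
    qed
    moreover have "coeff Q 1 / coeff P 1 \<noteq> 0" using lead True by simp
    ultimately show ?thesis using that one_neq_zero by blast
  next
    case False
    then have "degree P = Suc (Suc (degree P - 2))" using P(1) by simp
    then obtain m where m: "degree P = Suc (Suc m)" by blast
    have "coeff Q (Suc m) =
        a * (b ^ Suc m * (coeff P (Suc m) + of_nat (Suc (Suc m)) * c * coeff P (Suc (Suc m))))"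
      unfolding Qeq coeff_affine_pcompose using m by (subst coeff_pcompose_subleading) auto
    then have "of_nat (Suc (Suc m)) * c * coeff P (Suc (Suc m)) = 0"
      using P Q ab m by simp
    then have c: "c = 0" using lead m by (auto simp del: of_nat_Suc)
    have co: "coeff Q n = (if n = 0 then k else 0) + a * (b ^ n * coeff P n)" for n
      unfolding Qeq coeff_affine_pcompose c by (simp add: coeff_pcompose_linear)
    then have "k = 0" using co[of 0] P Q by simp
    then show ?thesis using that[OF ab] co by (simp add: mult.assoc)
  qed
qed

lemma rho_equivalent_coeff_eq_0_iff:
  fixes P Q :: "'a::field_char_0 poly"
  assumes "affine_equivalent P Q" "rho_polynomial P" "rho_polynomial Q"
  shows "coeff Q n = 0 \<longleftrightarrow> coeff P n = 0"
proof -
  obtain a b where "a \<noteq> 0" "b \<noteq> 0" "\<And>n. coeff Q n = a * b ^ n * coeff P n"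
    using rho_equivalent_imp_scaling[OF assms] by blast
  then show ?thesis by simp
qed

lemma rho_equivalent_imp_same_shape:
  fixes P Q :: "'a::field_char_0 poly"
  assumes "affine_equivalent P Q" "rho_polynomial P" "rho_polynomial Q"
  shows "has_bidegree P d e \<longleftrightarrow> has_bidegree Q d e" "poly_support P = poly_support Q"
  by (simp_all add: has_bidegree_iff_coeff poly_support_def
      rho_equivalent_coeff_eq_0_iff[OF assms] degree_affine_equivalent[OF assms(1)])

section \<open>Existence of \<open>\<delta>\<close>-polynomials\<close>

lemma radically_closed_root:
  fixes a :: "'a::field"
  assumes "radically_closed TYPE('a)" "n \<ge> 2"
  obtains b where "b ^ n = a"
proof -
  \<comment> \<open>The degree shows that there is at least one linear factor, and it provides the root.\<close>
  obtain c xs where c: "c \<noteq> 0" "monom 1 n - [:a:] = smult c (\<Prod>x\<leftarrow>xs. [:- x, 1:])"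
    using assms unfolding radically_closed_def splits_into_linear_def by blast
  have "degree (monom 1 n - [:a:]) = n"
    using assms(2) by (intro antisym degree_le le_degree) (auto simp: coeff_pCons split: nat.splits)
  moreover have "degree (smult c (\<Prod>x\<leftarrow>[]. [:- x, 1:])) = 0" by simp
  ultimately have "xs \<noteq> []" using c assms(2) by auto
  then obtain b ys where "xs = b # ys" by (cases xs) auto
  then have "poly (monom 1 n - [:a:]) b = 0" using c by simp
  then have "b ^ n = a" by (simp add: poly_monom)
  then show ?thesis by (rule that)
qed

lemma affine_equivalent_trans:
  assumes "affine_equivalent P Q" "affine_equivalent Q R"
  shows "affine_equivalent P R"
proof -
  obtain k a c b k' a' c' b' where "a \<noteq> 0" "b \<noteq> 0" "Q = pcompose [:k, a:] (pcompose P [:c, b:])"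
    "a' \<noteq> 0" "b' \<noteq> 0" "R = pcompose [:k', a':] (pcompose Q [:c', b':])"
    using assms unfolding affine_equivalent_def by blast
  moreover from this have "R = pcompose (pcompose [:k', a':] [:k, a:]) (pcompose P (pcompose [:c, b:] [:c', b':]))"
    by (simp only: pcompose_assoc)
  ultimately have "R = pcompose [:k' + a' * k, a' * a:] (pcompose P [:c + b * c', b * b':])"
      "a' * a \<noteq> 0" "b * b' \<noteq> 0"
    by (simp_all add: pcompose_pCons algebra_simps)
  then show ?thesis unfolding affine_equivalent_def by blast
qed

text \<open>
  An inner translation kills the coefficient below the leading one, and an outer translation then
  kills the constant term. Their order also works in degree \<open>1\<close>, where the two
  coefficients are the same.
\<close>

lemma exists_equivalent_rho:
  fixes P :: "'a::field_char_0 poly"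
  assumes "1 \<le> degree P"
  obtains Q where "affine_equivalent P Q" "rho_polynomial Q"
proof -
  define n where "n = degree P - 1"
  have n: "degree P = Suc n" using assms by (simp add: n_def)
  have lead: "coeff P (Suc n) \<noteq> 0" using n by (metis leading_coeff_0_iff degree_0 nat.distinct(1))
  \<comment> \<open>the zero of the coefficient of \<open>X\<close> to the power \<open>n\<close> as a function of the translation\<close>
  define c where "c = - coeff P n / (of_nat (Suc n) * coeff P (Suc n))"
  define R where "R = pcompose P [:c, 1:]"
  define Q where "Q = pcompose [:- coeff R 0, 1:] R"
  have eq: "affine_equivalent P Q"
    unfolding affine_equivalent_def Q_def R_def using one_neq_zero by blast
  have "coeff R n = 0"
    unfolding R_def using lead n by (subst coeff_pcompose_subleading) (auto simp: c_def simp del: of_nat_Suc)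
  then have "coeff Q n = 0" "coeff Q 0 = 0"
    by (auto simp: Q_def coeff_affine_pcompose)
  then have "rho_polynomial Q"
    using degree_affine_equivalent[OF eq] n by (simp add: rho_polynomial_iff_coeff)
  with eq show ?thesis by (rule that)
qed

text \<open>
  Substituting \<open>b X\<close> and normalising the leading coefficient multiplies the ratio of the
  coefficients at \<open>e\<close> and \<open>d\<close> by the inverse of the power of \<open>b\<close> with
  exponent \<open>d - e\<close>, so a suitable radical \<open>b\<close> turns this ratio into \<open>d\<close>.
\<close>

lemma rho_imp_exists_equivalent_delta:
  fixes P :: "'a::field_char_0 poly"
  assumes "radically_closed TYPE('a)" "rho_polynomial P"
  obtains Q where "affine_equivalent P Q" "delta_polynomial Q"
proof -
  define d where "d = degree P"
  have P: "1 \<le> d" "coeff P 0 = 0" "coeff P (d - 1) = 0"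
    using assms(2) by (auto simp: rho_polynomial_iff_coeff d_def)
  have lead: "coeff P d \<noteq> 0" using P by (auto simp: d_def)
  have scaling: thesis
    if b: "b \<noteq> 0" and delta: "\<And>Q. affine_equivalent P Q \<Longrightarrow> degree Q = d \<Longrightarrow>
        (\<And>n. coeff Q n = b ^ n * coeff P n / (b ^ d * coeff P d)) \<Longrightarrow> delta_polynomial Q" for b
  proof -
    define Q where "Q = pcompose [:0, 1 / (b ^ d * coeff P d):] (pcompose P [:0, b:])"
    have "1 / (b ^ d * coeff P d) \<noteq> 0" using b lead by simp
    then have eq: "affine_equivalent P Q"
      unfolding affine_equivalent_def Q_def using b by blast
    have "coeff Q n = b ^ n * coeff P n / (b ^ d * coeff P d)" for n
      by (simp add: Q_def coeff_affine_pcompose coeff_pcompose_linear)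
    then show thesis
      using \<open>\<And>Q. affine_equivalent P Q \<Longrightarrow> delta_polynomial Q \<Longrightarrow> thesis\<close> delta eq
        degree_affine_equivalent[OF eq] d_def by metis
  qed
  from monom_or_has_bidegree[of P] P
  consider "P = monom (coeff P d) d" | e where "has_bidegree P d e"
    by (auto simp: d_def)
  then show thesis
  proof cases
    case 1
    then have z: "coeff P n = 0" if "n \<noteq> d" for n using that by (metis coeff_monom)
    show thesis
    proof (rule scaling[of 1])
      fix Q assume "degree Q = d" and "\<And>n. coeff Q n = 1 ^ n * coeff P n / (1 ^ d * coeff P d)"
      then have "Q = monom 1 (degree Q)"
        using z lead by (intro poly_eqI) auto
      then show "delta_polynomial Q" by (simp add: delta_polynomial_iff_coeff)
    qed simp
  next
    case 2
    then have e: "1 \<le> e" "e + 2 \<le> d" "coeff P e \<noteq> 0" by (auto simp: has_bidegree_iff_coeff)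
    have "2 \<le> d - e" using e by simp
    then obtain b where b: "b ^ (d - e) = coeff P e / (of_nat d * coeff P d)"
      using radically_closed_root[OF assms(1)] by blast
    have "b ^ (d - e) \<noteq> 0" using b e lead by simp
    then have b0: "b \<noteq> 0" using e by (auto simp: power_0_left)
    have "b ^ d = b ^ e * b ^ (d - e)" using e by (simp flip: power_add)
    then have bd: "b ^ e * coeff P e / (b ^ d * coeff P d) = of_nat d"
      using b b0 e lead by (simp add: field_simps)
    show thesis
    proof (rule scaling[OF b0])
      fix Q assume Q: "degree Q = d" "\<And>n. coeff Q n = b ^ n * coeff P n / (b ^ d * coeff P d)"
      have "has_bidegree Q d e"
        using 2 Q b0 lead by (simp add: has_bidegree_iff_coeff)
      moreover have "lead_coeff Q = 1" "coeff Q e = of_nat d"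
        using Q b0 lead bd by auto
      ultimately show "delta_polynomial Q"
        using Q by (auto simp: delta_polynomial_iff_coeff)
    qed
  qed
qed

lemma exists_equivalent_delta:
  fixes P :: "'a::field_char_0 poly"
  assumes "radically_closed TYPE('a)"
  obtains Q where "affine_equivalent P Q" "delta_polynomial Q"
proof (cases "degree P = 0")
  case True
  then obtain p where "P = [:p:]" by (rule degree_eq_zeroE)
  then have "1 = pcompose [:1 - p, 1:] (pcompose P [:0, 1:])"
    by (simp add: pcompose_pCons one_pCons)
  \<comment> \<open>All constants form one orbit, and the \<open>\<delta>\<close>-polynomial in it is \<open>X\<^sup>0\<close>.\<close>
  then have "affine_equivalent P 1"
    unfolding affine_equivalent_def using one_neq_zero by blast
  moreover have "delta_polynomial (1 :: 'a poly)"
    by (simp add: delta_polynomial_iff_coeff)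
  ultimately show ?thesis by (rule that)
next
  case False
  then obtain R where "affine_equivalent P R" "rho_polynomial R"
    using exists_equivalent_rho[of P] by auto
  then show ?thesis
    using rho_imp_exists_equivalent_delta[OF assms, of R] affine_equivalent_trans that by metis
qed

section \<open>Counting \<open>\<delta>\<close>-polynomials\<close>

lemma finite_card_roots_of_unity:
  fixes n :: nat
  assumes "0 < n"
  shows "finite {b::'a::field. b ^ n = 1}" "card {b::'a. b ^ n = 1} \<le> n"
proof -
  let ?p = "monom 1 n - 1 :: 'a poly"
  have "coeff ?p n = 1" using assms by simp
  then have nz: "?p \<noteq> 0" by (metis coeff_0 zero_neq_one)
  have eq: "{b::'a. b ^ n = 1} = {b. poly ?p b = 0}" by (auto simp: poly_monom)
  show "finite {b::'a. b ^ n = 1}" unfolding eq using nz by (rule poly_roots_finite)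
  have "card {b. poly ?p b = 0} \<le> degree ?p" using nz by (rule card_poly_roots_bound)
  also have "\<dots> \<le> n" by (intro degree_diff_le) (auto simp: degree_monom_le)
  finally show "card {b::'a. b ^ n = 1} \<le> n" unfolding eq .
qed

text \<open>
  The exponent \<open>e\<close> is not chosen here but given by the bi-degree; uniqueness of the
  bi-degree identifies it with the one in the definition of \<open>\<delta>\<close>-polynomials.
\<close>

lemma delta_has_bidegree_coeff:
  fixes P :: "'a::field_char_0 poly"
  assumes "delta_polynomial P" "has_bidegree P d e"
  shows "coeff P d = 1" "coeff P e = of_nat d"
proof -
  have P: "degree P = d" "coeff P e \<noteq> 0" "e < d"
    using assms(2) by (auto simp: has_bidegree_iff_coeff)
  then have "P \<noteq> monom 1 (degree P)" by (metis coeff_monom nat_neq_iff)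
  then obtain e' where e': "has_bidegree P d e'" "coeff P d = 1" "coeff P e' = of_nat d"
    using assms(1) P(1) unfolding delta_polynomial_iff_coeff by blast
  moreover have "e = e'" using has_bidegree_unique(2)[OF assms(2) e'(1)] .
  ultimately show "coeff P d = 1" "coeff P e = of_nat d" by simp_all
qed

text \<open>
  Both polynomials have the same bi-degree, hence the same coefficients \<open>1\<close> at \<open>d\<close>
  and \<open>d\<close> at \<open>e\<close>. For \<open>Q = a P(b X)\<close> this says that \<open>a\<close> times the power
  of \<open>b\<close> is \<open>1\<close> for both exponents; dividing the two equations leaves the exponent
  \<open>d - e\<close>.
\<close>

lemma delta_equivalent_imp_root_of_unity:
  fixes P Q :: "'a::field_char_0 poly"
  assumes "affine_equivalent P Q" "delta_polynomial P" "has_bidegree P d e" "delta_polynomial Q"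
  obtains b where "b ^ (d - e) = 1" "Q = smult (1 / b ^ d) (pcompose P [:0, b:])"
proof -
  have P: "degree P = d" "1 \<le> e" "e + 2 \<le> d" using assms(3) by (auto simp: has_bidegree_iff_coeff)
  then have "1 \<le> degree P" "1 \<le> degree Q"
    using degree_affine_equivalent[OF assms(1)] by auto
  then have rho: "rho_polynomial P" "rho_polynomial Q"
    using delta_polynomial_imp_rho assms(2,4) by blast+
  then have bi: "has_bidegree Q d e"
    using rho_equivalent_imp_same_shape(1)[OF assms(1)] assms(3) by blast
  obtain a b where ab: "a \<noteq> 0" "b \<noteq> 0" "\<And>n. coeff Q n = a * b ^ n * coeff P n"
    using rho_equivalent_imp_scaling[OF assms(1) rho] by blast
  note cP = delta_has_bidegree_coeff[OF assms(2,3)]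
  note cQ = delta_has_bidegree_coeff[OF assms(4) bi]
  have d: "a * b ^ d = 1" using ab(3)[of d] cP cQ by simp
  have e: "a * b ^ e = 1" using ab(3)[of e] cP cQ P by simp
  have "b ^ d = b ^ (d - e) * b ^ e" using P by (simp flip: power_add)
  then have "b ^ (d - e) = 1" 
    using d e ab by (metis mult_cancel_left mult_cancel_right1 power_not_zero)
  moreover have "a = 1 / b ^ d" using d ab by (simp add: field_simps)
  then have "Q = smult (1 / b ^ d) (pcompose P [:0, b:])"
    by (intro poly_eqI) (simp add: ab(3) coeff_pcompose_linear)
  ultimately show ?thesis by (rule that)
qed

lemma card_equivalent_delta:
  fixes P :: "'a::field_char_0 poly"
  assumes "delta_polynomial P" "has_bidegree P d e"
  shows "finite {Q. affine_equivalent P Q \<and> delta_polynomial Q}"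
    "card {Q. affine_equivalent P Q \<and> delta_polynomial Q} \<le> d - e"
proof -
  let ?D = "{Q. affine_equivalent P Q \<and> delta_polynomial Q}"
  let ?U = "{b::'a. b ^ (d - e) = 1}"
  have sub: "?D \<subseteq> (\<lambda>b. smult (1 / b ^ d) (pcompose P [:0, b:])) ` ?U"
    using delta_equivalent_imp_root_of_unity[OF _ assms] by blast
  have "0 < d - e" using assms(2) by (auto simp: has_bidegree_def)
  note U = finite_card_roots_of_unity[OF this, where 'a = 'a]
  show "finite ?D" using sub U(1) by (rule finite_surj[rotated])
  show "card ?D \<le> d - e" using surj_card_le[OF U(1) sub] U(2) by simp
qed

theorem proposition2p3:
  fixes \<O> :: "'a::field_char_0 poly set"
  assumes "radically_closed TYPE('a)"
    and "\<O> \<in> orbits (Aff \<times>\<times> Aff) UNIV aff_action"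
  shows "(\<forall>P\<in>\<O>. \<forall>Q\<in>\<O>. degree P = degree Q) \<and>
         (\<forall>P\<in>\<O>. \<forall>Q\<in>\<O>. rho_polynomial P \<longrightarrow> rho_polynomial Q \<longrightarrow>
            (\<forall>d e. has_bidegree P d e \<longleftrightarrow> has_bidegree Q d e) \<and>
            poly_support P = poly_support Q) \<and>
         (\<exists>P\<in>\<O>. delta_polynomial P) \<and>
         (\<forall>P\<in>\<O>. \<forall>d e. delta_polynomial P \<longrightarrow> has_bidegree P d e \<longrightarrow>
            finite {Q \<in> \<O>. delta_polynomial Q} \<and>
            card {Q \<in> \<O>. delta_polynomial Q} \<le> d - e)"
proof -
  interpret act: group_action "Aff \<times>\<times> Aff" "UNIV :: 'a poly set" aff_action
    by (rule group_action_aff)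
  have orb: "\<O> = {Q. affine_equivalent P Q}" if "P \<in> \<O>" for P
    using orbit_eq_affine_equivalent[OF assms(2) that] .
  have equiv: "affine_equivalent P Q" if "P \<in> \<O>" "Q \<in> \<O>" for P Q
    using orb[OF that(1)] that(2) by blast
  have "\<exists>P\<in>\<O>. delta_polynomial P"
  proof -
    obtain R where "R \<in> \<O>"
      using assms(2) act.orbit_refl by (auto simp: orbits_def)
    then show ?thesis
      using exists_equivalent_delta[OF assms(1), of R] orb by blast
  qed
  moreover have "finite {Q \<in> \<O>. delta_polynomial Q} \<and> card {Q \<in> \<O>. delta_polynomial Q} \<le> d - e"
    if "P \<in> \<O>" "delta_polynomial P" "has_bidegree P d e" for P d e
    using card_equivalent_delta[OF that(2,3)] orb[OF that(1)] by simp
  moreover have "degree P = degree Q" if "P \<in> \<O>" "Q \<in> \<O>" for P Q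
    using degree_affine_equivalent[OF equiv[OF that]] by simp
  moreover have "(\<forall>d e. has_bidegree P d e \<longleftrightarrow> has_bidegree Q d e) \<and> poly_support P = poly_support Q"
    if "P \<in> \<O>" "Q \<in> \<O>" "rho_polynomial P" "rho_polynomial Q" for P Q
    using rho_equivalent_imp_same_shape[OF equiv[OF that(1,2)] that(3,4)] by blast
  ultimately show ?thesis by blast
qed

end
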